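(* Let $W$ be a set and let $F:\mathscr P(W)\to\mathscr P(W)$ satisfy, for all $X,Y\subseteq W$: $F(X)\subseteq X$; if $X\neq\emptyset$ then $F(X)\neq\emptyset$; and $F(X\cap Y)\supseteq F(X)\cap Y$. Define $\mathrm{ob}:\mathscr P(W)\to\mathscr P(\mathscr P(W))$ by $\mathrm{ob}(X)=\{Y\subseteq W: Y\supseteq F(X)\}$. Then $\mathrm{ob}$ satisfies: for all $X,Y,Z\subseteq W$, if $Y\subseteq X$, $Y\in\mathrm{ob}(X)$ and $X\subseteq Z$, then $(Z\setminus X)\cup Y\in\mathrm{ob}(Z)$.
   Context: $F(X)$ is interpreted as the set of ideal worlds in context $X$. The conclusion is Carmo and Jones' condition 5(d). *)

theory Defs
  imports Main "HOL-Library.FuncSet"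
begin

definition ob :: "'a set \<Rightarrow> ('a set \<Rightarrow> 'a set) \<Rightarrow> 'a set \<Rightarrow> 'a set set" where
  "ob W F X = {Y \<in> Pow W. F X \<subseteq> Y}"

end

theory Submission
  imports Defs
begin

text \<open>Ideal worlds of a context stay ideal in any smaller context that contains them: if
  \<open>X \<subseteq> Z\<close>, then \<open>F Z \<inter> X \<subseteq> F X\<close>. So a world of
  \<open>F Z\<close> either lies outside \<open>X\<close>, hence in \<open>Z - X\<close>, or lies in
  \<open>F X\<close>, which is contained in \<open>Y\<close>.\<close>

theorem theorem2:
  fixes W :: "'a set" and F :: "'a set \<Rightarrow> 'a set"
  assumes "F \<in> Pow W \<rightarrow> Pow W"
    and "\<And>X. X \<subseteq> W \<Longrightarrow> F X \<subseteq> X"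
    and "\<And>X. X \<subseteq> W \<Longrightarrow> X \<noteq> {} \<Longrightarrow> F X \<noteq> {}"
    and "\<And>X Y. X \<subseteq> W \<Longrightarrow> Y \<subseteq> W \<Longrightarrow> F (X \<inter> Y) \<supseteq> F X \<inter> Y"
  shows "\<forall>X Y Z. X \<subseteq> W \<longrightarrow> Y \<subseteq> W \<longrightarrow> Z \<subseteq> W \<longrightarrow>
    Y \<subseteq> X \<longrightarrow> Y \<in> ob W F X \<longrightarrow> X \<subseteq> Z \<longrightarrow> (Z - X) \<union> Y \<in> ob W F Z"
proof (intro allI impI)
  fix X Y Z
  assume XYZ: "X \<subseteq> W" "Y \<subseteq> W" "Z \<subseteq> W" "X \<subseteq> Z" and "Y \<in> ob W F X"
  then have FX: "F X \<subseteq> Y" by (simp add: ob_def)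
  \<comment> \<open>This puts \<open>F X\<close> in the form \<open>F (Z \<inter> X)\<close>, so
    that the intersection condition applies with the larger context \<open>Z\<close> first.\<close>
  have "Z \<inter> X = X" using XYZ by blast
  then have "F Z \<inter> X \<subseteq> F X" using assms(4)[of Z X] XYZ by simp
  moreover have "F Z \<subseteq> Z" using assms(2) XYZ by simp
  \<comment> \<open>Case split on whether a world of \<open>F Z\<close> is in \<open>X\<close>; the
    bounds by \<open>W\<close> give membership in \<open>Pow W\<close>.\<close>
  ultimately show "(Z - X) \<union> Y \<in> ob W F Z" using FX XYZ unfolding ob_def by blast
qed

end
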